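(* For any positive integer $n$, $$\sum_{\pi\in\mathcal B_n}(-1)^{\ell_B(\pi)}t^{\mathrm{des}_B(\pi)}q^{\mathrm{maj}_B(\pi)} = \sum_{\pi\in\mathcal B_n}(-1)^{\mathrm{neg}(\pi)}t^{\mathrm{des}_B(\pi)}q^{\mathrm{maj}_B(\pi)} = \prod_{i=0}^{n-1}\left(1-tq^i\right).$$
   Context: $\mathcal B_n$ is the group of signed permutations: words $\pi=\pi_1\cdots\pi_n$ with $\pi_i\in\{\pm1,\dots,\pm n\}$ such that $|\pi_1|\cdots|\pi_n|$ is a permutation of $\{1,\dots,n\}$. $\mathrm{neg}(\pi)=|\{i:\pi_i<0\}|$. With respect to the natural order of integers: $\mathrm{inv}(\pi)=|\{(i,j):i<j,\ \pi_i>\pi_j\}|$; the type $B$ length is $\ell_B(\pi)=\mathrm{inv}(\pi)-\sum_{i:\,\pi_i<0}\pi_i$; $\mathrm{Des}_B(\pi)=\{i:0\le i\le n-1,\ \pi_i>\pi_{i+1}\}$ with $\pi_0:=0$; $\mathrm{des}_B(\pi)=|\mathrm{Des}_B(\pi)|$; $\mathrm{maj}_B(\pi)=\sum_{i\in\mathrm{Des}_B(\pi)}i$. $t,q$ are commuting indeterminates. *)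

theory Defs
  imports
    "HOL-Combinatorics.Multiset_Permutations"
    "HOL-Computational_Algebra.Polynomial"
begin

text \<open>
  A signed permutation is the word of its values; the condition on the absolute values
  forces the length to be n and the letters to lie in \<open>{\<plusminus>1, \<dots>, \<plusminus>n}\<close>.
\<close>

definition signed_perms :: "nat \<Rightarrow> int list set" where
  "signed_perms n = {\<pi>. map abs \<pi> \<in> permutations_of_set {1..int n}}"

text \<open>
  Letters are numbered from 1, with the convention that the letter at position 0 is 0.
\<close>

definition letter :: "int list \<Rightarrow> nat \<Rightarrow> int" where
  "letter \<pi> i = (0 # \<pi>) ! i"

definition neg :: "int list \<Rightarrow> nat" where
  "neg \<pi> = card {i \<in> {1..length \<pi>}. letter \<pi> i < 0}"

definition inv_word :: "int list \<Rightarrow> nat" where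
  "inv_word \<pi> =
     card {(i, j). 1 \<le> i \<and> i < j \<and> j \<le> length \<pi> \<and> letter \<pi> i > letter \<pi> j}"

text \<open>
  The integer inside \<open>nat\<close> is never negative, since only negative letters are subtracted;
  the conversion merely makes the length usable as an exponent.
\<close>

definition length_B :: "int list \<Rightarrow> nat" where
  "length_B \<pi> =
     nat (int (inv_word \<pi>) - (\<Sum>i \<in> {i \<in> {1..length \<pi>}. letter \<pi> i < 0}. letter \<pi> i))"

definition Des_B :: "int list \<Rightarrow> nat set" where
  "Des_B \<pi> = {i. i < length \<pi> \<and> letter \<pi> i > letter \<pi> (i + 1)}"

definition des_B :: "int list \<Rightarrow> nat" where
  "des_B \<pi> = card (Des_B \<pi>)"

definition maj_B :: "int list \<Rightarrow> nat" where
  "maj_B \<pi> = \<Sum> (Des_B \<pi>)"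

text \<open>
  The polynomial ring in two commuting indeterminates over the integers is modelled as
  polynomials in \<open>t\<close> whose coefficients are polynomials in \<open>q\<close>.
\<close>

definition indet_t :: "int poly poly" where
  "indet_t = [:0, 1:]"

definition indet_q :: "int poly poly" where
  "indet_q = [:[:0, 1:]:]"

end

theory Submission
  imports Defs
begin

text \<open>
  Negating the letter \<open>\<plusminus>1\<close> of a signed permutation leaves its comparisons with all the other letters
  unchanged, because they have larger absolute value; only the comparison with \<open>0\<close> is reversed, and
  that one matters for \<^const>\<open>Des_B\<close> just when \<open>\<plusminus>1\<close> is the first letter. The negation
  changes the sign \<open>(-1) ^ neg \<pi>\<close>, and also \<open>(-1) ^ length_B \<pi>\<close>: the inversions stay the
  same, and the sum of the negative letters moves by one. So in either sum the words whose first
  letter is not \<open>\<plusminus>1\<close> cancel in pairs.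

  What remains are the words \<open>\<plusminus>1 # up \<sigma>\<close>, where \<open>\<sigma>\<close> is a signed permutation of size one less
  and \<open>up\<close> moves every letter away from \<open>0\<close> by one. The rest of the word compares with the
  first letter as it does with \<open>0\<close>, so the descents of \<open>\<sigma>\<close> all move up by one position, and
  there is a further descent at \<open>0\<close> when the first letter is \<open>-1\<close>. The sign of \<open>1 # up \<sigma>\<close>
  is that of \<open>\<sigma>\<close>: for the length, each negative letter of \<open>\<sigma>\<close> contributes two, namely one new
  inversion and one from its growth in absolute value. Hence both sums satisfy
  \<open>F (n + 1) t q = (1 - t) * F n (t * q) q\<close>, which is the recurrence of the product. This argument,
  in \<open>signed_descent_sum\<close>, works for any sign with these two properties.
\<close>

section \<open>The statistics as recursions on words\<close>

lemma letter_0 [simp]: "letter \<pi> 0 = 0"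
  by (simp add: letter_def)

lemma letter_Suc [simp]: "letter \<pi> (Suc i) = \<pi> ! i"
  by (simp add: letter_def)

lemma positions_eq_image:
  "{i \<in> {1..length \<pi>}. P (letter \<pi> i)} = Suc ` {i. i < length \<pi> \<and> P (\<pi> ! i)}"
proof (intro equalityI subsetI)
  fix i assume "i \<in> {i \<in> {1..length \<pi>}. P (letter \<pi> i)}"
  then show "i \<in> Suc ` {i. i < length \<pi> \<and> P (\<pi> ! i)}"
    by (cases i) auto
qed auto

lemma card_positions:
  "card {i \<in> {1..length \<pi>}. P (letter \<pi> i)} = length (filter P \<pi>)"
  by (simp only: positions_eq_image) (simp add: card_image length_filter_conv_card)

lemma neg_eq_length_filter: "neg \<pi> = length (filter (\<lambda>a. a < 0) \<pi>)"
  unfolding neg_def by (rule card_positions)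

definition neg_sum :: "int list \<Rightarrow> int" where
  "neg_sum \<pi> = sum_list (map (min 0) \<pi>)"

lemma sum_negative_letters:
  "(\<Sum>i \<in> {i \<in> {1..length \<pi>}. letter \<pi> i < 0}. letter \<pi> i) = neg_sum \<pi>"
proof -
  have "(\<Sum>i \<in> {i \<in> {1..length \<pi>}. letter \<pi> i < 0}. letter \<pi> i)
      = (\<Sum>i \<in> {i. i < length \<pi> \<and> \<pi> ! i < 0}. \<pi> ! i)"
    unfolding positions_eq_image[of \<pi> "\<lambda>a. a < 0"] by (subst sum.reindex) auto
  also have "\<dots> = (\<Sum>i \<in> {0..<length \<pi>}. min 0 (\<pi> ! i))"
    by (rule sum.mono_neutral_cong_left) auto
  also have "\<dots> = neg_sum \<pi>"
    by (simp add: neg_sum_def sum_list_sum_nth)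
  finally show ?thesis .
qed

lemma inv_word_Cons:
  "inv_word (a # \<pi>) = length (filter (\<lambda>b. b < a) \<pi>) + inv_word \<pi>"
proof -
  let ?I = "\<lambda>\<pi>. {(i, j). 1 \<le> i \<and> i < j \<and> j \<le> length \<pi> \<and> letter \<pi> i > letter \<pi> j}"
  let ?J = "{j \<in> {1..length \<pi>}. letter \<pi> j < a}"
  have fin: "finite (?I \<pi>)" for \<pi> :: "int list"
    by (rule finite_subset[of _ "{..length \<pi>} \<times> {..length \<pi>}"]) auto
  \<comment> \<open>Pairs whose left member is the new first letter, and those lying in the old word.\<close>
  have split: "?I (a # \<pi>) = (\<lambda>j. (1 :: nat, Suc j)) ` ?J \<union> map_prod Suc Suc ` ?I \<pi>"
  proof (intro equalityI subsetI)
    fix p assume p: "p \<in> ?I (a # \<pi>)"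
    obtain i j where ij: "p = (Suc i, Suc (Suc j))" "i < Suc j" "j < length \<pi>"
        "(a # \<pi>) ! i > \<pi> ! j"
    proof -
      obtain i j where "p = (i, j)" by (cases p)
      with p show ?thesis
        by (cases i; cases j; cases "j - 1") (auto intro!: that)
    qed
    then show "p \<in> (\<lambda>j. (1 :: nat, Suc j)) ` ?J \<union> map_prod Suc Suc ` ?I \<pi>"
      by (cases i) (auto simp: image_iff)
  next
    fix p assume "p \<in> (\<lambda>j. (1 :: nat, Suc j)) ` ?J \<union> map_prod Suc Suc ` ?I \<pi>"
    then show "p \<in> ?I (a # \<pi>)"
    proof
      assume "p \<in> (\<lambda>j. (1 :: nat, Suc j)) ` ?J"
      then obtain j where "p = (1, Suc j)" "j \<in> ?J" by blast
      then show ?thesis by (cases j) auto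
    next
      assume "p \<in> map_prod Suc Suc ` ?I \<pi>"
      then obtain i j where "p = (Suc i, Suc j)" "(i, j) \<in> ?I \<pi>" by auto
      then show ?thesis by (cases i; cases j) auto
    qed
  qed
  have "inv_word (a # \<pi>) = card ((\<lambda>j. (1 :: nat, Suc j)) ` ?J) + card (map_prod Suc Suc ` ?I \<pi>)"
    unfolding inv_word_def split by (subst card_Un_disjoint) (use fin[of \<pi>] in auto)
  also have "card ((\<lambda>j. (1 :: nat, Suc j)) ` ?J) = length (filter (\<lambda>b. b < a) \<pi>)"
    by (subst card_image) (auto intro: inj_onI simp: card_positions[of \<pi> "\<lambda>b. b < a", simplified])
  also have "card (map_prod Suc Suc ` ?I \<pi>) = inv_word \<pi>"
    unfolding inv_word_def by (rule card_image) (auto intro: inj_onI)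
  finally show ?thesis .
qed

lemma inv_word_Nil [simp]: "inv_word [] = 0"
  unfolding inv_word_def by (rule card_eq_0_iff[THEN iffD2]) auto

lemma int_length_B: "int (length_B \<pi>) = int (inv_word \<pi>) - neg_sum \<pi>"
proof -
  have "neg_sum \<pi> \<le> 0"
    unfolding neg_sum_def by (induction \<pi>) auto
  then show ?thesis
    unfolding length_B_def sum_negative_letters by simp
qed

text \<open>
  The next two lemmas reduce the effect of a letterwise map to which comparisons it keeps: all
  pairs of letters matter for inversions, but only neighbours, and \<open>0\<close> with the first letter, for
  descents.
\<close>

lemma inv_word_map:
  assumes "sorted_wrt (\<lambda>a b. f b < f a \<longleftrightarrow> b < a) \<pi>"
  shows "inv_word (map f \<pi>) = inv_word \<pi>"
  using assms
proof (induction \<pi>)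
  case (Cons a \<pi>)
  then have "filter (\<lambda>b. f b < f a) \<pi> = filter (\<lambda>b. b < a) \<pi>"
    by (intro filter_cong) auto
  with Cons show ?case
    by (simp add: inv_word_Cons filter_map o_def)
qed simp

lemma Des_B_map:
  assumes "\<And>i. i < length \<pi> \<Longrightarrow>
    f (letter \<pi> (Suc i)) < f (letter \<pi> i) \<longleftrightarrow> letter \<pi> (Suc i) < letter \<pi> i"
    and "f 0 = 0"
  shows "Des_B (map f \<pi>) = Des_B \<pi>"
proof -
  have "letter (map f \<pi>) i = f (letter \<pi> i)" if "i \<le> length \<pi>" for i
    using that assms(2) by (cases i) auto
  then show ?thesis
    using assms(1) by (auto simp: Des_B_def)
qed

text \<open>
  A first letter \<open>c = \<plusminus>1\<close> compares with letters of absolute value above \<open>1\<close> as the letter \<open>0\<close>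
  in position \<open>0\<close> does, so it can take over the role of that \<open>0\<close> for the rest of the word.
\<close>

lemma Des_B_Cons_unit:
  assumes "\<bar>c\<bar> = 1" and "\<And>a. a \<in> set \<pi> \<Longrightarrow> \<bar>a\<bar> > 1"
  shows "Des_B (c # \<pi>) = (if c < 0 then {0} else {}) \<union> Suc ` Des_B \<pi>"
proof -
  have shift: "Suc i \<in> Des_B (c # \<pi>) \<longleftrightarrow> i \<in> Des_B \<pi>" for i
  proof (cases i)
    case 0
    show ?thesis
    proof (cases \<pi>)
      case (Cons a \<rho>)
      with assms(2) have "\<bar>a\<bar> > 1" by simp
      with \<open>\<bar>c\<bar> = 1\<close> have "a < c \<longleftrightarrow> a < 0" by linarith
      with 0 Cons show ?thesis by (simp add: Des_B_def)
    qed (simp add: Des_B_def)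
  qed (simp add: Des_B_def)
  have zero: "0 \<in> Des_B (c # \<pi>) \<longleftrightarrow> c < 0"
    by (simp add: Des_B_def)
  show ?thesis
  proof (intro set_eqI)
    fix i show "i \<in> Des_B (c # \<pi>) \<longleftrightarrow> i \<in> (if c < 0 then {0} else {}) \<union> Suc ` Des_B \<pi>"
      using zero shift by (cases i) auto
  qed
qed

lemma finite_Des_B [simp]: "finite (Des_B \<pi>)"
  by (simp add: Des_B_def)

section \<open>Negating the smallest letter\<close>

definition flip :: "int list \<Rightarrow> int list" where
  "flip \<pi> = map (\<lambda>a. if \<bar>a\<bar> = 1 then - a else a) \<pi>"

lemma flip_flip [simp]: "flip (flip \<pi>) = \<pi>"
  by (induction \<pi>) (auto simp: flip_def)

lemma map_abs_flip [simp]: "map abs (flip \<pi>) = map abs \<pi>"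
  by (simp add: flip_def)

lemma signed_perms_iff:
  "\<pi> \<in> signed_perms n \<longleftrightarrow> distinct (map abs \<pi>) \<and> abs ` set \<pi> = {1..int n}"
  by (auto simp: signed_perms_def permutations_of_set_def)

lemma flip_in_signed_perms [simp]: "flip \<pi> \<in> signed_perms n \<longleftrightarrow> \<pi> \<in> signed_perms n"
  by (simp add: signed_perms_def)

lemma signed_perms_nonzero: "\<pi> \<in> signed_perms n \<Longrightarrow> 0 \<notin> set \<pi>"
  by (force simp: signed_perms_iff)

text \<open>
  No integer lies strictly between \<open>- 1\<close> and \<open>1\<close> except \<open>0\<close>, so negating \<open>\<plusminus>1\<close> can reverse only
  comparisons with \<open>0\<close> or with \<open>\<plusminus>1\<close> itself, and the hypotheses rule these out.
\<close>

lemma flip_letter_less_iff: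
  fixes a b :: int
  assumes "\<bar>a\<bar> \<noteq> \<bar>b\<bar>" "a = 0 \<longrightarrow> \<bar>b\<bar> \<noteq> 1" "b \<noteq> 0"
  shows "(if \<bar>b\<bar> = 1 then - b else b) < (if \<bar>a\<bar> = 1 then - a else a) \<longleftrightarrow> b < a"
  using assms by (auto split: if_splits)

lemma inv_word_flip:
  assumes "distinct (map abs \<pi>)" "0 \<notin> set \<pi>"
  shows "inv_word (flip \<pi>) = inv_word \<pi>"
  unfolding flip_def
proof (rule inv_word_map)
  show "sorted_wrt (\<lambda>a b. (if \<bar>b\<bar> = 1 then - b else b) < (if \<bar>a\<bar> = 1 then - a else a)
      \<longleftrightarrow> b < a) \<pi>"
    using assms
  proof (induction \<pi>)
    case (Cons a \<pi>)
    have "(if \<bar>b\<bar> = 1 then - b else b) < (if \<bar>a\<bar> = 1 then - a else a) \<longleftrightarrow> b < a"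
      if "b \<in> set \<pi>" for b
      using that Cons.prems by (intro flip_letter_less_iff) (auto simp: image_iff)
    with Cons show ?case by simp
  qed simp
qed

text \<open>
  The first letter is the only one that \<^const>\<open>Des_B\<close> compares with \<open>0\<close>, hence the condition on it.
\<close>

lemma Des_B_flip:
  assumes "distinct (map abs \<pi>)" "0 \<notin> set \<pi>" "\<bar>hd \<pi>\<bar> \<noteq> 1"
  shows "Des_B (flip \<pi>) = Des_B \<pi>"
  unfolding flip_def
proof (rule Des_B_map)
  fix i assume i: "i < length \<pi>"
  then have nz: "\<pi> ! i \<noteq> 0"
    using assms(2) by (metis nth_mem)
  show "(if \<bar>letter \<pi> (Suc i)\<bar> = 1 then - letter \<pi> (Suc i) else letter \<pi> (Suc i))
      < (if \<bar>letter \<pi> i\<bar> = 1 then - letter \<pi> i else letter \<pi> i)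
      \<longleftrightarrow> letter \<pi> (Suc i) < letter \<pi> i"
  proof (cases i)
    case 0
    with i assms(3) have "\<bar>\<pi> ! 0\<bar> \<noteq> 1"
      by (simp add: hd_conv_nth)
    with 0 nz show ?thesis
      by simp
  next
    case (Suc k)
    have "map abs \<pi> ! k \<noteq> map abs \<pi> ! i"
      using i Suc assms(1) by (subst nth_eq_iff_index_eq) auto
    moreover have "\<pi> ! k \<noteq> 0"
      using i Suc assms(2) by (metis Suc_lessD nth_mem)
    ultimately show ?thesis
      using i nz Suc by (intro flip_letter_less_iff) auto
  qed
qed simp

lemma flip_no_unit: "1 \<notin> abs ` set \<pi> \<Longrightarrow> flip \<pi> = \<pi>"
  unfolding flip_def by (induction \<pi>) auto

lemma odd_neg_flip:
  assumes "distinct (map abs \<pi>)" "1 \<in> abs ` set \<pi>"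
  shows "odd (neg (flip \<pi>) + neg \<pi>)"
  using assms
proof (induction \<pi>)
  case (Cons a \<pi>)
  show ?case
  proof (cases "\<bar>a\<bar> = 1")
    case True
    with Cons.prems have "flip \<pi> = \<pi>"
      by (intro flip_no_unit) auto
    with True show ?thesis
      by (auto simp: neg_eq_length_filter flip_def)
  next
    case False
    with Cons have "odd (neg (flip \<pi>) + neg \<pi>)" by auto
    with False show ?thesis
      by (auto simp: neg_eq_length_filter flip_def)
  qed
qed simp

lemma odd_neg_sum_flip:
  assumes "distinct (map abs \<pi>)" "1 \<in> abs ` set \<pi>"
  shows "odd (neg_sum (flip \<pi>) + neg_sum \<pi>)"
  using assms
proof (induction \<pi>)
  case (Cons a \<pi>)
  show ?case
  proof (cases "\<bar>a\<bar> = 1")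
    case True
    with Cons.prems have "flip \<pi> = \<pi>"
      by (intro flip_no_unit) auto
    moreover from True have "a = 1 \<or> a = - 1" by linarith
    ultimately show ?thesis
      by (auto simp: neg_sum_def flip_def)
  next
    case False
    with Cons have "odd (neg_sum (flip \<pi>) + neg_sum \<pi>)" by auto
    with False show ?thesis
      by (simp add: neg_sum_def flip_def)
  qed
qed simp

text \<open>
  The number of inversions is kept, so the parity of the length changes with the sum of the negative
  letters, which gains or loses the letter \<open>- 1\<close>.
\<close>

lemma odd_length_B_flip:
  assumes "\<pi> \<in> signed_perms n" "n > 0"
  shows "odd (length_B (flip \<pi>) + length_B \<pi>)"
proof -
  have \<pi>: "distinct (map abs \<pi>)" "1 \<in> abs ` set \<pi>" "0 \<notin> set \<pi>"
    using assms signed_perms_nonzero by (auto simp: signed_perms_iff)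
  have "int (length_B (flip \<pi>) + length_B \<pi>)
      = 2 * int (inv_word \<pi>) - (neg_sum (flip \<pi>) + neg_sum \<pi>)"
    using inv_word_flip[OF \<pi>(1,3)] by (simp add: int_length_B)
  moreover have "odd \<dots>"
    using odd_neg_sum_flip[OF \<pi>(1,2)] by simp
  ultimately show ?thesis
    by (metis even_of_nat)
qed

section \<open>Signed permutations that begin with the smallest letter\<close>

definition up :: "int list \<Rightarrow> int list" where
  "up \<pi> = map (\<lambda>a. a + sgn a) \<pi>"

lemma add_sgn_less_iff: "b + sgn b < a + sgn a \<longleftrightarrow> b < (a :: int)"
  by (auto simp: sgn_if)

lemma neg_up [simp]: "neg (up \<pi>) = neg \<pi>"
  unfolding neg_eq_length_filter up_def by (induction \<pi>) (auto simp: sgn_if)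

lemma inv_word_up [simp]: "inv_word (up \<pi>) = inv_word \<pi>"
  unfolding up_def
  by (rule inv_word_map) (simp add: add_sgn_less_iff sorted_wrt_true)

lemma Des_B_up [simp]: "Des_B (up \<pi>) = Des_B \<pi>"
  unfolding up_def by (rule Des_B_map) (simp_all add: add_sgn_less_iff del: letter_Suc)

lemma neg_sum_up: "neg_sum (up \<pi>) = neg_sum \<pi> - int (neg \<pi>)"
  unfolding neg_eq_length_filter neg_sum_def up_def by (induction \<pi>) (auto simp: sgn_if)

lemma abs_up_gt_1: "0 \<notin> set \<pi> \<Longrightarrow> a \<in> set (up \<pi>) \<Longrightarrow> \<bar>a\<bar> > 1"
  by (auto simp: up_def sgn_if)

lemma neg_Cons_1_up: "neg (1 # up \<pi>) = neg \<pi>"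
  using neg_up[of \<pi>] by (simp add: neg_eq_length_filter)

text \<open>
  Each negative letter contributes twice: it forms an inversion with the new first letter, and its
  own absolute value grows by one.
\<close>

lemma length_B_Cons_1_up:
  assumes "0 \<notin> set \<pi>"
  shows "length_B (1 # up \<pi>) = length_B \<pi> + 2 * neg \<pi>"
proof -
  have "filter (\<lambda>a. a < 1) (up \<pi>) = filter (\<lambda>a. a < 0) (up \<pi>)"
    using abs_up_gt_1[OF assms] by (intro filter_cong) force+
  then have "inv_word (1 # up \<pi>) = neg \<pi> + inv_word \<pi>"
    using neg_up[of \<pi>] by (simp add: inv_word_Cons neg_eq_length_filter)
  moreover have "neg_sum (1 # up \<pi>) = neg_sum \<pi> - int (neg \<pi>)"
    using neg_sum_up[of \<pi>] by (simp add: neg_sum_def)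
  ultimately have "int (length_B (1 # up \<pi>)) = int (length_B \<pi> + 2 * neg \<pi>)"
    by (simp add: int_length_B)
  then show ?thesis by simp
qed

lemma inj_up: "inj up"
proof -
  have "inj (\<lambda>a :: int. a + sgn a)"
    by (rule injI) (auto simp: sgn_if split: if_splits)
  then show ?thesis
    unfolding up_def[abs_def] by simp
qed

lemma signed_perms_hd_1:
  "{\<pi> \<in> signed_perms (Suc n). \<pi> \<noteq> [] \<and> hd \<pi> = 1} = (\<lambda>\<sigma>. 1 # up \<sigma>) ` signed_perms n"
proof (intro equalityI subsetI)
  fix \<pi> assume "\<pi> \<in> {\<pi> \<in> signed_perms (Suc n). \<pi> \<noteq> [] \<and> hd \<pi> = 1}"
  then obtain \<rho> where \<rho>: "\<pi> = 1 # \<rho>" and \<pi>: "1 # \<rho> \<in> signed_perms (Suc n)"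
    by (cases \<pi>) auto
  from \<pi> have d: "distinct (map abs \<rho>)" and n1: "1 \<notin> abs ` set \<rho>"
    and s: "insert 1 (abs ` set \<rho>) = {1..int (Suc n)}"
    by (auto simp: signed_perms_iff)
  have "abs ` set \<rho> = {1..int (Suc n)} - {1}"
    using n1 unfolding s[symmetric] by blast
  also have "\<dots> = {2..int (Suc n)}"
    by auto
  finally have s': "abs ` set \<rho> = {2..int (Suc n)}" .
  \<comment> \<open>The preimage moves every letter back towards \<open>0\<close>; none reaches it, as all exceed \<open>1\<close> in absolute value.\<close>
  let ?\<sigma> = "map (\<lambda>a. a - sgn a) \<rho>"
  have big: "\<bar>a\<bar> \<ge> 2" if "a \<in> set \<rho>" for a
    using that s' by (metis atLeastAtMost_iff imageI)
  have "map (\<lambda>a. a - sgn a + sgn (a - sgn a)) \<rho> = map (\<lambda>a. a) \<rho>"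
    using big by (intro map_cong) (force simp: sgn_if)+
  then have "up ?\<sigma> = \<rho>"
    by (simp add: up_def o_def)
  moreover have "map abs ?\<sigma> = map (\<lambda>a. a - 1) (map abs \<rho>)"
    using big by (force simp: sgn_if)
  then have "distinct (map abs ?\<sigma>)" "set (map abs ?\<sigma>) = (\<lambda>a. a - 1) ` abs ` set \<rho>"
    using d by (simp_all only: distinct_map set_map) (auto simp: inj_on_def)
  then have "?\<sigma> \<in> signed_perms n"
    unfolding signed_perms_iff s' by (simp add: image_image image_minus_const_atLeastAtMost')
  ultimately show "\<pi> \<in> (\<lambda>\<sigma>. 1 # up \<sigma>) ` signed_perms n"
    unfolding \<rho> by (intro image_eqI[of _ _ ?\<sigma>]) simp_all
next
  fix \<pi> assume "\<pi> \<in> (\<lambda>\<sigma>. 1 # up \<sigma>) ` signed_perms n"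
  then obtain \<sigma> where \<pi>: "\<pi> = 1 # up \<sigma>" and \<sigma>: "\<sigma> \<in> signed_perms n" by blast
  have "map abs (up \<sigma>) = map (\<lambda>a. a + 1) (map abs \<sigma>)"
    using signed_perms_nonzero[OF \<sigma>] by (auto simp: up_def sgn_if)
  then have "distinct (map abs (up \<sigma>))" "set (map abs (up \<sigma>)) = (\<lambda>a. a + 1) ` abs ` set \<sigma>"
    using \<sigma> by (simp_all only: distinct_map set_map signed_perms_iff) (auto simp: inj_on_def)
  then have "distinct (map abs (up \<sigma>))" "abs ` set (up \<sigma>) = {2..int (Suc n)}"
    using \<sigma> by (simp_all add: signed_perms_iff)
  then show "\<pi> \<in> {\<pi> \<in> signed_perms (Suc n). \<pi> \<noteq> [] \<and> hd \<pi> = 1}"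
    unfolding \<pi> by (auto simp: signed_perms_iff)
qed

section \<open>The signed descent generating function\<close>

definition descent_weight :: "'a::comm_ring_1 \<Rightarrow> 'a \<Rightarrow> int list \<Rightarrow> 'a" where
  "descent_weight x y \<pi> = x ^ des_B \<pi> * y ^ maj_B \<pi>"

text \<open>
  As a product over the descents, the weight visibly depends on \<^const>\<open>Des_B\<close> alone, and moving
  every descent up by one position amounts to replacing \<open>x\<close> by \<open>x * y\<close>.
\<close>

lemma descent_weight_eq_prod: "descent_weight x y \<pi> = (\<Prod>i\<in>Des_B \<pi>. x * y ^ i)"
  by (simp add: descent_weight_def des_B_def maj_B_def prod.distrib power_sum)

lemma descent_weight_Cons_unit:
  assumes "\<bar>c\<bar> = 1" "0 \<notin> set \<sigma>"
  shows "descent_weight x y (c # up \<sigma>) = (if c < 0 then x else 1) * descent_weight (x * y) y \<sigma>"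
proof -
  have "Des_B (c # up \<sigma>) = (if c < 0 then {0} else {}) \<union> Suc ` Des_B \<sigma>"
    using Des_B_Cons_unit[OF assms(1), of "up \<sigma>"] abs_up_gt_1[OF assms(2)] by simp
  moreover have "(\<Prod>i\<in>Suc ` Des_B \<sigma>. x * y ^ i) = descent_weight (x * y) y \<sigma>"
    by (subst prod.reindex) (auto simp: descent_weight_eq_prod mult.assoc)
  ultimately show ?thesis
    by (auto simp: descent_weight_eq_prod[of x y "c # up \<sigma>"])
qed

lemma finite_signed_perms [simp]: "finite (signed_perms n)"
proof (rule finite_subset)
  show "signed_perms n \<subseteq> {\<pi>. set \<pi> \<subseteq> {- int n..int n} \<and> length \<pi> = n}"
  proof
    fix \<pi> assume \<pi>: "\<pi> \<in> signed_perms n"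
    then have "map abs \<pi> \<in> permutations_of_set {1..int n}"
      by (simp add: signed_perms_def)
    then have "length \<pi> = n"
      using length_finite_permutations_of_set by fastforce
    moreover have "a \<in> {- int n..int n}" if "a \<in> set \<pi>" for a
    proof -
      have "\<bar>a\<bar> \<in> {1..int n}" using \<pi> that by (auto simp: signed_perms_iff)
      then show ?thesis by auto
    qed
    ultimately show "\<pi> \<in> {\<pi>. set \<pi> \<subseteq> {- int n..int n} \<and> length \<pi> = n}" by blast
  qed
qed (simp add: finite_lists_length_eq)

lemma signed_perms_0: "signed_perms 0 = {[]}"
  by (auto simp: signed_perms_iff)

text \<open>
  Exactly one of \<open>\<pi>\<close> and \<open>flip \<pi>\<close> contains the letter \<open>1\<close>, the other containing \<open>- 1\<close>. Summing over
  these pairs, rather than deducing \<open>S = - S\<close>, gives cancellation in every characteristic.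
\<close>

lemma sum_signed_perms_flip:
  fixes g :: "int list \<Rightarrow> 'a::comm_monoid_add"
  shows "(\<Sum>\<pi>\<in>signed_perms (Suc n). g \<pi>)
    = (\<Sum>\<pi>\<in>{\<pi> \<in> signed_perms (Suc n). 1 \<in> set \<pi>}. g \<pi> + g (flip \<pi>))"
proof -
  let ?P = "{\<pi> \<in> signed_perms (Suc n). 1 \<in> set \<pi>}"
  have mem: "1 \<in> set (flip \<pi>) \<longleftrightarrow> 1 \<notin> set \<pi>" if "\<pi> \<in> signed_perms (Suc n)" for \<pi>
  proof -
    have \<pi>: "distinct (map abs \<pi>)" "1 \<in> abs ` set \<pi>"
      using that by (auto simp: signed_perms_iff)
    then obtain c where c: "c \<in> set \<pi>" "\<bar>c\<bar> = 1" by fastforce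
    have unique: "a = c" if "a \<in> set \<pi>" "\<bar>a\<bar> = 1" for a
      using \<pi>(1) that c by (metis distinct_map inj_onD)
    have "1 \<in> set (flip \<pi>) \<longleftrightarrow> - 1 \<in> set \<pi>"
      by (force simp: flip_def)
    moreover have "- 1 \<in> set \<pi> \<longleftrightarrow> 1 \<notin> set \<pi>"
    proof -
      from c(2) have "c = 1 \<or> c = - 1" by linarith
      with c(1) show ?thesis
        using unique[of 1] unique[of "- 1"] by auto
    qed
    ultimately show ?thesis by simp
  qed
  have inj: "inj_on flip ?P"
    by (rule inj_on_inverseI[of _ flip]) simp
  have image: "flip ` ?P = signed_perms (Suc n) - ?P"
  proof (intro equalityI subsetI)
    fix \<pi> assume "\<pi> \<in> signed_perms (Suc n) - ?P"
    then have "flip \<pi> \<in> ?P" using mem by auto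
    then show "\<pi> \<in> flip ` ?P" by (metis flip_flip imageI)
  qed (use mem in auto)
  have "(\<Sum>\<pi>\<in>signed_perms (Suc n). g \<pi>)
      = (\<Sum>\<pi>\<in>signed_perms (Suc n) - ?P. g \<pi>) + (\<Sum>\<pi>\<in>?P. g \<pi>)"
    by (rule sum.subset_diff) auto
  also have "(\<Sum>\<pi>\<in>signed_perms (Suc n) - ?P. g \<pi>) = (\<Sum>\<pi>\<in>?P. g (flip \<pi>))"
    unfolding image[symmetric] by (simp add: sum.reindex[OF inj])
  finally show ?thesis
    by (simp add: sum.distrib add.commute)
qed

text \<open>
  The two hypotheses on \<open>w\<close> besides the normalisation are all that the argument uses of the signs
  \<open>(-1) ^ neg \<pi>\<close> and \<open>(-1) ^ length_B \<pi>\<close>. Flip pairs not beginning with \<open>\<plusminus>1\<close> cancel; a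
  pair \<open>\<plusminus>1 # up \<sigma>\<close> contributes \<open>1 - x\<close> times the term of \<open>\<sigma>\<close> with \<open>x * y\<close> for \<open>x\<close>,
  which is why the induction must leave \<open>x\<close> arbitrary.
\<close>

theorem signed_descent_sum:
  fixes x y :: "'a::comm_ring_1" and w :: "int list \<Rightarrow> 'a"
  assumes Nil: "w [] = 1"
    and flip: "\<And>n \<pi>. \<pi> \<in> signed_perms (Suc n) \<Longrightarrow> w (flip \<pi>) = - w \<pi>"
    and Cons: "\<And>n \<sigma>. \<sigma> \<in> signed_perms n \<Longrightarrow> w (1 # up \<sigma>) = w \<sigma>"
  shows "(\<Sum>\<pi>\<in>signed_perms n. w \<pi> * descent_weight x y \<pi>) = (\<Prod>i<n. 1 - x * y ^ i)"
proof (induction n arbitrary: x)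
  case 0
  show ?case
    by (simp add: signed_perms_0 Nil descent_weight_eq_prod Des_B_def)
next
  case (Suc n)
  let ?P = "{\<pi> \<in> signed_perms (Suc n). 1 \<in> set \<pi>}"
  let ?H = "{\<pi> \<in> signed_perms (Suc n). \<pi> \<noteq> [] \<and> hd \<pi> = 1}"
  let ?g = "\<lambda>\<pi>. w \<pi> * descent_weight x y \<pi>"
  have cancel: "?g \<pi> + ?g (flip \<pi>) = 0" if \<pi>: "\<pi> \<in> ?P - ?H" for \<pi>
  proof -
    from \<pi> have d: "distinct (map abs \<pi>)" and "1 \<in> set \<pi>" "hd \<pi> \<noteq> 1" "\<pi> \<noteq> []"
      by (auto simp: signed_perms_iff)
    then have "\<bar>hd \<pi>\<bar> \<noteq> 1"
      by (metis abs_1 distinct_map hd_in_set inj_onD)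
    then have "Des_B (flip \<pi>) = Des_B \<pi>"
      using \<pi> d signed_perms_nonzero by (intro Des_B_flip) auto
    with \<pi> flip[of \<pi> n] show ?thesis
      by (simp add: descent_weight_eq_prod)
  qed
  have keep: "?g (1 # up \<sigma>) + ?g (flip (1 # up \<sigma>)) = (1 - x) * (w \<sigma> * descent_weight (x * y) y \<sigma>)"
    if \<sigma>: "\<sigma> \<in> signed_perms n" for \<sigma>
  proof -
    have nz: "0 \<notin> set \<sigma>"
      using \<sigma> by (rule signed_perms_nonzero)
    then have "1 \<notin> abs ` set (up \<sigma>)"
      using abs_up_gt_1 by force
    then have "flip (up \<sigma>) = up \<sigma>" by (rule flip_no_unit)
    then have eq: "flip (1 # up \<sigma>) = - 1 # up \<sigma>"
      by (simp add: flip_def)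
    have "1 # up \<sigma> \<in> signed_perms (Suc n)"
      using signed_perms_hd_1[of n] \<sigma> by blast
    then have "w (flip (1 # up \<sigma>)) = - w \<sigma>"
      using flip Cons[OF \<sigma>] by simp
    then show ?thesis
      using nz by (simp add: eq Cons[OF \<sigma>] descent_weight_Cons_unit algebra_simps)
  qed
  have "(\<Sum>\<pi>\<in>signed_perms (Suc n). ?g \<pi>) = (\<Sum>\<pi>\<in>?P. ?g \<pi> + ?g (flip \<pi>))"
    by (rule sum_signed_perms_flip)
  also have "\<dots> = (\<Sum>\<pi>\<in>?H. ?g \<pi> + ?g (flip \<pi>))"
  proof (rule sum.mono_neutral_right)
    show "?H \<subseteq> ?P" using hd_in_set by fastforce
  qed (use cancel in auto)
  also have "\<dots> = (\<Sum>\<sigma>\<in>signed_perms n. ?g (1 # up \<sigma>) + ?g (flip (1 # up \<sigma>)))"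
    unfolding signed_perms_hd_1
    by (subst sum.reindex) (use inj_up in \<open>auto simp: inj_on_def\<close>)
  also have "\<dots> = (1 - x) * (\<Prod>i<n. 1 - x * y * y ^ i)"
    by (simp add: keep Suc.IH sum_distrib_left[symmetric])
  also have "\<dots> = (\<Prod>i<Suc n. 1 - x * y ^ i)"
    by (simp only: prod.lessThan_Suc_shift) (simp add: mult.assoc)
  finally show ?case .
qed

lemma neg_one_power_odd_add:
  assumes "odd (m + k)"
  shows "(- 1 :: 'a::comm_ring_1) ^ m = - ((- 1) ^ k)"
  using assms by (cases "even m") auto

theorem theorem5p1:
  fixes n :: nat
  assumes "n > 0"
  shows "(\<Sum>\<pi>\<in>signed_perms n. (-1) ^ length_B \<pi> * indet_t ^ des_B \<pi> * indet_q ^ maj_B \<pi>)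
           = (\<Sum>\<pi>\<in>signed_perms n. (-1) ^ neg \<pi> * indet_t ^ des_B \<pi> * indet_q ^ maj_B \<pi>)
       \<and> (\<Sum>\<pi>\<in>signed_perms n. (-1) ^ neg \<pi> * indet_t ^ des_B \<pi> * indet_q ^ maj_B \<pi>)
           = (\<Prod>i = 0..n - 1. 1 - indet_t * indet_q ^ i)"
proof -
  have length: "(\<Sum>\<pi>\<in>signed_perms n. (-1) ^ length_B \<pi> * descent_weight indet_t indet_q \<pi>)
      = (\<Prod>i<n. 1 - indet_t * indet_q ^ i)"
  proof (rule signed_descent_sum)
    show "(- 1 :: int poly poly) ^ length_B (flip \<pi>) = - ((- 1) ^ length_B \<pi>)"
      if "\<pi> \<in> signed_perms (Suc n)" for n \<pi>
      using odd_length_B_flip[OF that zero_less_Suc] by (rule neg_one_power_odd_add)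
    show "(- 1 :: int poly poly) ^ length_B (1 # up \<sigma>) = (- 1) ^ length_B \<sigma>" if "\<sigma> \<in> signed_perms n" for n \<sigma>
      using length_B_Cons_1_up[OF signed_perms_nonzero[OF that]]
      by (simp add: power_add power_mult)
  qed (simp add: length_B_def)
  have neg: "(\<Sum>\<pi>\<in>signed_perms n. (-1) ^ neg \<pi> * descent_weight indet_t indet_q \<pi>)
      = (\<Prod>i<n. 1 - indet_t * indet_q ^ i)"
  proof (rule signed_descent_sum)
    show "(- 1 :: int poly poly) ^ neg (flip \<pi>) = - ((- 1) ^ neg \<pi>)" if "\<pi> \<in> signed_perms (Suc n)" for n \<pi>
      using that by (intro neg_one_power_odd_add odd_neg_flip) (auto simp: signed_perms_iff)
    show "(- 1 :: int poly poly) ^ neg (1 # up \<sigma>) = (- 1) ^ neg \<sigma>" if "\<sigma> \<in> signed_perms n" for n \<sigma>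
      by (simp add: neg_Cons_1_up)
  qed (simp add: neg_def)
  have "{0..n - 1} = {..<n}"
    using assms by auto
  with length neg show ?thesis
    by (simp add: descent_weight_def mult.assoc)
qed

end
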